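(* The following two statements are equivalent. (A) For all positive integers $n,k,r$ with $k\geq 2$, $r\geq 2$ and $n\geq rk$: $\chi\left(KG^{r}(n,k)_{\widetilde{r\text{-}stab}}\right)=\left\lceil \frac{n-r(k-1)}{r-1}\right\rceil$. (B) For all positive integers $n,k,r,s$ with $k\geq 2$, $r\geq 2$ and $n\geq \max(\{r,s\})k$: $\chi\left(KG^{r}(n,k)_{\widetilde{s\text{-}stab}}\right)=\left\lceil \frac{n-\max(\{r,s\})(k-1)}{r-1}\right\rceil$.
   Context: For a positive integer $s$, a $k$-subset $S\subseteq[n]$ is almost $s$-stable if $|i-j|\geq s$ for all distinct $i,j\in S$. $KG^{r}(n,k)_{\widetilde{s\text{-}stab}}$ is the $r$-uniform hypergraph whose vertices are the almost $s$-stable $k$-subsets of $[n]$ and whose edges are the $r$-element sets of pairwise disjoint such subsets. A proper coloring of a hypergraph assigns colors to vertices so that no edge is monochromatic; $\chi$ is the minimum number of colors in a proper coloring. *)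

theory Defs
  imports Complex_Main
begin

type_synonym 'a hypergraph = "'a set \<times> 'a set set"

definition proper_coloring :: "'a hypergraph \<Rightarrow> ('a \<Rightarrow> nat) \<Rightarrow> bool" where
  "proper_coloring H f \<longleftrightarrow> (\<forall>e\<in>snd H. \<not> (\<exists>c. \<forall>v\<in>e. f v = c))"

(* The value carries information only if some proper coloring with finitely many colors exists;
   this is always so when there are finitely many vertices and every edge has at least two
   elements. *)
definition chromatic_number :: "'a hypergraph \<Rightarrow> nat" where
  "chromatic_number H =
     (LEAST m. \<exists>f. proper_coloring H f \<and> f ` fst H \<subseteq> {..<m})"

definition almost_stable :: "nat \<Rightarrow> nat set \<Rightarrow> bool" where
  "almost_stable s S \<longleftrightarrow> (\<forall>i\<in>S. \<forall>j\<in>S. i \<noteq> j \<longrightarrow> \<bar>int i - int j\<bar> \<ge> int s)"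

definition almost_stable_subsets :: "nat \<Rightarrow> nat \<Rightarrow> nat \<Rightarrow> nat set set" where
  "almost_stable_subsets s n k = {S. S \<subseteq> {1..n} \<and> card S = k \<and> almost_stable s S}"

definition almost_stable_KG :: "nat \<Rightarrow> nat \<Rightarrow> nat \<Rightarrow> nat \<Rightarrow> nat set hypergraph" where
  "almost_stable_KG r s n k =
     (almost_stable_subsets s n k,
      {e. e \<subseteq> almost_stable_subsets s n k \<and> card e = r \<and> pairwise disjnt e})"

end

theory Submission
  imports Defs
begin

text \<open>
  Statement (A) is the case \<open>s = r\<close> of (B). Conversely, the upper bound is the usual greedy colouring
  by the least element, and for \<open>s \<le> r\<close> the lower bound holds because the almost \<open>r\<close>-stable sets
  are among the almost \<open>s\<close>-stable ones. For \<open>s > r\<close>, let a proper colouring of the \<open>r\<close>-uniform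
  hypergraph on \<open>[n]\<close> with \<open>c\<close> colours be given. Append one block of \<open>s - r\<close> new points for each
  colour, and give a set meeting the new points the colour of a block it meets. Among \<open>s\<close> pairwise
  disjoint sets of colour \<open>i\<close> at most \<open>s - r\<close> meet block \<open>i\<close>, so \<open>r\<close> of them would already form a
  monochromatic edge on \<open>[n]\<close>. This properly colours the \<open>s\<close>-uniform hypergraph of almost
  \<open>s\<close>-stable sets on \<open>n + c (s - r)\<close> points, and (A) with \<open>r = s\<close> gives
  \<open>n + c (s - r) - s (k - 1) \<le> c (s - 1)\<close>, that is, \<open>n - s (k - 1) \<le> c (r - 1)\<close>.
\<close>

section \<open>Colourings and the chromatic number\<close>

lemma chromatic_number_le:
  assumes "proper_coloring H f" "f ` fst H \<subseteq> {..<m}"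
  shows "chromatic_number H \<le> m"
  unfolding chromatic_number_def using assms by (blast intro: Least_le)

text \<open>A \<open>LEAST\<close> is attained only when some value qualifies; the colouring
  \<open>g\<close> supplies one.\<close>

lemma obtain_optimal_coloring:
  assumes "proper_coloring H g" "g ` fst H \<subseteq> {..<m}"
  obtains f where "proper_coloring H f" "f ` fst H \<subseteq> {..<chromatic_number H}"
proof -
  have "\<exists>f. proper_coloring H f \<and> f ` fst H \<subseteq> {..<chromatic_number H}"
    unfolding chromatic_number_def
    by (rule LeastI[where P = "\<lambda>m. \<exists>f. proper_coloring H f \<and> f ` fst H \<subseteq> {..<m}"])
      (use assms in blast)
  then show thesis using that by blast
qed

lemma proper_coloring_almost_stable_KG:
  "proper_coloring (almost_stable_KG r s n k) f \<longleftrightarrow>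
     (\<forall>e c. e \<subseteq> almost_stable_subsets s n k \<and> card e = r \<and> pairwise disjnt e \<longrightarrow>
        \<not> (\<forall>S\<in>e. f S = c))"
  unfolding proper_coloring_def almost_stable_KG_def by auto

section \<open>Almost stable sets and disjoint families\<close>

lemma almost_stable_mono:
  assumes "s \<le> r" "almost_stable r S"
  shows "almost_stable s S"
  using assms unfolding almost_stable_def by fastforce

text \<open>Induction on the cardinality: deleting the maximum lowers it by at least
  \<open>s\<close>, while the minimum can only grow.\<close>

lemma almost_stable_Min_Max:
  assumes "card S = Suc j" "almost_stable s S"
  shows "Min S + s * j \<le> Max S"
  using assms
proof (induction j arbitrary: S)
  case 0
  then obtain x where "S = {x}" by (metis One_nat_def card_1_singletonE)
  then show ?case by simp
next
  case (Suc j)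
  define T where "T = S - {Max S}"
  have fin: "finite S" using Suc.prems by (metis card.infinite nat.distinct(1))
  have "Max S \<in> S" using fin Suc.prems by (metis Max_in card.empty nat.distinct(1))
  then have card_T: "card T = Suc j" unfolding T_def using Suc.prems fin by simp
  have st: "almost_stable s T" using Suc.prems unfolding almost_stable_def T_def by blast
  have "T \<noteq> {}" using card_T by auto
  have "finite T" using fin by (simp add: T_def)
  note T = \<open>T \<noteq> {}\<close> this
  have "Max T \<in> T" using T by simp
  then have "Max T \<in> S" "Max T \<noteq> Max S" by (auto simp: T_def)
  moreover have "Max T \<le> Max S" using \<open>Max T \<in> S\<close> fin by simp
  ultimately have "Max T + s \<le> Max S"
    using Suc.prems(2) \<open>Max S \<in> S\<close> unfolding almost_stable_def by fastforce
  moreover have "Min S \<le> Min T" using T fin by (intro Min_antimono) (auto simp: T_def)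
  moreover have "Min T + s * j \<le> Max T" using Suc.IH[OF card_T st] .
  ultimately show ?case by simp
qed

text \<open>Disjointness makes the choice \<open>g\<close> of representatives injective. It is
  applied to minima in the greedy colouring and to maxima for the appended blocks.\<close>

lemma card_le_if_disjoint_representatives:
  assumes "pairwise disjnt e" "\<And>S. S \<in> e \<Longrightarrow> g S \<in> S" "g ` e \<subseteq> A" "finite A"
  shows "card e \<le> card A"
proof -
  have "inj_on g e"
    using assms(1,2) unfolding inj_on_def pairwise_def disjnt_def by (metis disjoint_iff)
  then show ?thesis using assms(3,4) by (rule card_inj_on_le)
qed

lemma almost_stable_subsetsD:
  assumes "S \<in> almost_stable_subsets s n k" "k \<ge> 1"
  shows "finite S" "S \<noteq> {}" "Min S \<in> S" "1 \<le> Min S" "Min S + s * (k - 1) \<le> n"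
proof -
  have S: "S \<subseteq> {1..n}" "card S = k" "almost_stable s S"
    using assms by (auto simp: almost_stable_subsets_def)
  show fin: "finite S" using S(1) finite_subset by blast
  show ne: "S \<noteq> {}" using S assms by auto
  show "Min S \<in> S" using fin ne by simp
  then show "1 \<le> Min S" using S(1) by auto
  have "Max S \<in> S" using fin ne by simp
  then have "Max S \<le> n" using S(1) by auto
  moreover have "Min S + s * (k - 1) \<le> Max S"
    using S assms by (intro almost_stable_Min_Max) auto
  ultimately show "Min S + s * (k - 1) \<le> n" by simp
qed

text \<open>The positive integers are cut into consecutive blocks of length \<open>d\<close>,
  numbered from 0; the quotient is the number of the block containing \<open>x\<close>.\<close>

lemma pred_div_eq_imp_mem_block:
  fixes x d i :: nat
  assumes "(x - 1) div d = i" "1 \<le> x" "0 < d"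
  shows "x \<in> {i * d <.. i * d + d}"
  using dividend_less_div_times[of d "x - 1"] div_times_less_eq_dividend[of "x - 1" d] assms(2,3)
  unfolding assms(1) by auto

section \<open>The greedy upper bound\<close>

lemma almost_stable_KG_coloring:
  assumes "r \<ge> 2" "k \<ge> 1" "m \<ge> 1" "n \<le> m * (r - 1) + max r s * (k - 1)"
  obtains f where "proper_coloring (almost_stable_KG r s n k) f"
    "f ` fst (almost_stable_KG r s n k) \<subseteq> {..<m}"
proof -
  define f where "f S = min ((Min S - 1) div (r - 1)) (m - 1)" for S :: "nat set"
  \<comment> \<open>The first \<open>m - 1\<close> colours use up the minima from 1 to
    \<open>b\<close>, in blocks of \<open>r - 1\<close>; all larger minima share the last
    colour.\<close>
  define b where "b = (m - 1) * (r - 1)"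
  have n_le: "n \<le> b + (r - 1) + max r s * (k - 1)"
    using assms(3,4) by (cases m) (auto simp: b_def)
  have "False" if e: "e \<subseteq> almost_stable_subsets s n k" "card e = r" "pairwise disjnt e"
    and c: "\<forall>S\<in>e. f S = c" for e c
  proof -
    note e_D = almost_stable_subsetsD[OF subsetD[OF e(1)] assms(2)]
    have few_Mins: "\<not> Min ` e \<subseteq> A" if "finite A" "card A \<le> r - 1" for A
      using card_le_if_disjoint_representatives[OF e(3), of Min A] e_D(3) e(2) that assms(1)
      by fastforce
    show False
    proof (cases "c < m - 1")
      case True
      have "Min ` e \<subseteq> {c * (r - 1) <.. c * (r - 1) + (r - 1)}"
      proof
        fix x assume "x \<in> Min ` e"
        then obtain S where S: "S \<in> e" "x = Min S" by blast
        then have "(x - 1) div (r - 1) = c" using c True by (auto simp: f_def min_def split: if_splits)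
        then show "x \<in> {c * (r - 1) <.. c * (r - 1) + (r - 1)}"
          using e_D(4)[OF S(1)] S(2) assms(1) by (intro pred_div_eq_imp_mem_block) auto
      qed
      then show False using few_Mins by fastforce
    next
      case False
      have gt: "b < Min S" if "S \<in> e" for S
      proof -
        have "m - 1 \<le> (Min S - 1) div (r - 1)"
          using c False that by (auto simp: f_def min_def split: if_splits)
        then have "b \<le> Min S - 1"
          unfolding b_def using assms(1) by (simp add: less_eq_div_iff_mult_less_eq)
        then show ?thesis using e_D(4)[OF that] by simp
      qed
      show False
      proof (cases "s \<ge> r")
        case True
        \<comment> \<open>The maximum is at most \<open>n\<close> and exceeds the minimum by at
          least \<open>s * (k - 1)\<close>, which again leaves only \<open>r - 1\<close> possible
          minima.\<close>
        have "Min ` e \<subseteq> {b <.. b + (r - 1)}"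
          using gt e_D(5) n_le True by (fastforce simp: max_def)
        then show False using few_Mins by fastforce
      next
        case False
        \<comment> \<open>For \<open>s < r\<close> the gaps are too short to confine the minima, so
          points are counted: \<open>r\<close> disjoint \<open>k\<close>-sets would have to fit into
          at most \<open>r * k - 1\<close> points.\<close>
        have "\<Union>e \<subseteq> {b <.. n}"
        proof
          fix x assume "x \<in> \<Union>e"
          then obtain S where S: "S \<in> e" "x \<in> S" by blast
          then have "Min S \<le> x" using e_D(1) by simp
          moreover have "x \<le> n" using S subsetD[OF e(1) S(1)] by (auto simp: almost_stable_subsets_def)
          ultimately show "x \<in> {b <.. n}" using gt[OF S(1)] by simp
        qed
        then have "card (\<Union>e) \<le> n - b" using card_mono[of "{b <.. n}" "\<Union>e"] by simp
        moreover have "card (\<Union>e) = sum card e"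
          using e(3) e_D(1) by (intro card_Union_disjoint) auto
        moreover have "sum card e = r * k"
          using e(1,2) by (subst sum.cong[of e e card "\<lambda>_. k"]) (auto simp: almost_stable_subsets_def)
        ultimately have "r * k \<le> (r - 1) + r * (k - 1)" using n_le False by (simp add: max_def)
        then show False using assms(1,2) by (cases k) auto
      qed
    qed
  qed
  then have "proper_coloring (almost_stable_KG r s n k) f"
    unfolding proper_coloring_almost_stable_KG by blast
  moreover have "f ` fst (almost_stable_KG r s n k) \<subseteq> {..<m}"
    using assms(3) by (auto simp: f_def)
  ultimately show thesis using that by blast
qed

section \<open>Lower bounds by transferring colourings\<close>

lemma chromatic_number_almost_stable_KG_antimono:
  assumes "r \<ge> 2" "k \<ge> 1" "s \<le> t"
  shows "chromatic_number (almost_stable_KG r t n k) \<le> chromatic_number (almost_stable_KG r s n k)"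
proof -
  \<comment> \<open>A generous number of colours suffices here: the aim is only that a finite
    colouring exists, hence an optimal one.\<close>
  have "n \<le> Suc n * (r - 1) + max r s * (k - 1)" using assms(1) by (cases "r - 1") auto
  then obtain g where "proper_coloring (almost_stable_KG r s n k) g"
    "g ` fst (almost_stable_KG r s n k) \<subseteq> {..<Suc n}"
    using almost_stable_KG_coloring[of r k "Suc n" n s] assms by auto
  then obtain f where f: "proper_coloring (almost_stable_KG r s n k) f"
    "f ` fst (almost_stable_KG r s n k) \<subseteq> {..<chromatic_number (almost_stable_KG r s n k)}"
    by (rule obtain_optimal_coloring)
  have sub: "almost_stable_subsets t n k \<subseteq> almost_stable_subsets s n k"
    using assms(3) by (auto simp: almost_stable_subsets_def intro: almost_stable_mono)
  show ?thesis
  proof (rule chromatic_number_le)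
    show "proper_coloring (almost_stable_KG r t n k) f"
      using f(1) sub unfolding proper_coloring_almost_stable_KG by (blast intro: order_trans)
    show "f ` fst (almost_stable_KG r t n k) \<subseteq> {..<chromatic_number (almost_stable_KG r s n k)}"
      using f(2) sub by (auto simp: almost_stable_KG_def)
  qed
qed

text \<open>The uniformity rises from \<open>r\<close> to \<open>s\<close> while the stability
  \<open>t\<close> stays fixed. With \<open>t = s\<close> the enlarged hypergraph is one that (A)
  speaks about.\<close>

lemma chromatic_number_append_blocks:
  assumes "r \<le> s" "k \<ge> 1"
    and f: "proper_coloring (almost_stable_KG r t n k) f" "f ` fst (almost_stable_KG r t n k) \<subseteq> {..<c}"
  shows "chromatic_number (almost_stable_KG s t (n + c * (s - r)) k) \<le> c"
proof -
  define d where "d = s - r"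
  define V where "V = almost_stable_subsets t (n + c * d) k"
  \<comment> \<open>The maximum is the new point that decides the colour; block \<open>i\<close>
    runs from \<open>n + i * d + 1\<close> to \<open>n + i * d + d\<close>. If \<open>d = 0\<close>,
    no member of \<open>V\<close> has new points, so the division by zero is never reached.\<close>
  define g where "g S = (if S \<subseteq> {1..n} then f S else (Max S - n - 1) div d)" for S
  have small: "S \<in> almost_stable_subsets t n k" if "S \<in> V" "S \<subseteq> {1..n}" for S
    using that by (auto simp: V_def almost_stable_subsets_def)
  have big: "Max S \<in> S" "n < Max S" "Max S \<le> n + c * d" if "S \<in> V" "\<not> S \<subseteq> {1..n}" for S
  proof -
    have S: "finite S" "S \<noteq> {}" "S \<subseteq> {1..n + c * d}"
      using that(1) almost_stable_subsetsD(1,2)[of S] assms(2)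
      by (auto simp: V_def almost_stable_subsets_def)
    show "Max S \<in> S" using S by simp
    then show "Max S \<le> n + c * d" using S(3) by auto
    obtain x where "x \<in> S" "x \<notin> {1..n}" using \<open>\<not> S \<subseteq> {1..n}\<close> by blast
    then have "n < x" using S(3) by fastforce
    then show "n < Max S" using \<open>x \<in> S\<close> S(1) by (meson Max_ge less_le_trans)
  qed
  have "False" if e: "e \<subseteq> V" "card e = s" "pairwise disjnt e" and mono: "\<forall>S\<in>e. g S = i" for e i
  proof -
    define e1 where "e1 = {S \<in> e. S \<subseteq> {1..n}}"
    define e2 where "e2 = {S \<in> e. \<not> S \<subseteq> {1..n}}"
    have fin: "finite e"
      using e(1) by (rule finite_subset) (auto simp: V_def almost_stable_subsets_def)
    \<comment> \<open>Disjoint sets have distinct maxima, so confining these to block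
      \<open>i\<close> leaves at most \<open>d\<close> sets with new points.\<close>
    have "Max ` e2 \<subseteq> {n + i * d <.. n + i * d + d}"
    proof
      fix x assume "x \<in> Max ` e2"
      then obtain S where S: "S \<in> e" "\<not> S \<subseteq> {1..n}" "x = Max S" by (auto simp: e2_def)
      then have "S \<in> V" using e(1) by blast
      note x = big[OF this S(2), folded S(3)]
      have "(x - n - 1) div d = i" using mono[rule_format, OF S(1)] S(2,3) by (simp add: g_def)
      moreover have "d > 0" using x by (cases d) auto
      ultimately have "x - n \<in> {i * d <.. i * d + d}"
        using x(2) by (intro pred_div_eq_imp_mem_block) auto
      then show "x \<in> {n + i * d <.. n + i * d + d}" using x(2) by auto
    qed
    then have "card e2 \<le> card {n + i * d <.. n + i * d + d}"
    proof (intro card_le_if_disjoint_representatives)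
      show "pairwise disjnt e2" using e(3) by (auto simp: e2_def pairwise_def)
      show "Max S \<in> S" if "S \<in> e2" for S using that e(1) by (intro big(1)) (auto simp: e2_def)
    qed simp_all
    then have "card e2 \<le> d" by simp
    moreover have "card e = card e1 + card e2"
      using fin by (subst card_Un_disjoint[symmetric]) (auto simp: e1_def e2_def intro: arg_cong[where f = card])
    \<comment> \<open>At least \<open>s - d = r\<close> sets remain within the old points, where
      \<open>g\<close> agrees with \<open>f\<close>.\<close>
    ultimately have "r \<le> card e1" using e(2) assms(1) by (simp add: d_def)
    then obtain e0 where e0: "e0 \<subseteq> e1" "card e0 = r" by (meson obtain_subset_with_card_n)
    have S: "S \<in> e" "S \<subseteq> {1..n}" if "S \<in> e0" for S using that e0(1) by (auto simp: e1_def)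
    have "e0 \<subseteq> almost_stable_subsets t n k" using S small e(1) by blast
    moreover have "pairwise disjnt e0" using e(3) S(1) by (meson pairwise_subset subsetI)
    moreover have "\<forall>S\<in>e0. f S = i" using S mono unfolding g_def by metis
    ultimately show False using f(1) e0(2) unfolding proper_coloring_almost_stable_KG by blast
  qed
  then have "proper_coloring (almost_stable_KG s t (n + c * d) k) g"
    unfolding proper_coloring_almost_stable_KG V_def by blast
  moreover have "g ` fst (almost_stable_KG s t (n + c * d) k) \<subseteq> {..<c}"
  proof -
    have "g S < c" if S: "S \<in> V" for S
    proof (cases "S \<subseteq> {1..n}")
      case True
      then show ?thesis using small[OF S] f(2) by (auto simp: g_def almost_stable_KG_def)
    next
      case False
      then have "Max S - n - 1 < c * d" using big[OF S] by auto
      then show ?thesis using False by (simp add: g_def less_mult_imp_div_less)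
    qed
    then show ?thesis by (auto simp: V_def almost_stable_KG_def)
  qed
  ultimately show ?thesis unfolding d_def by (rule chromatic_number_le)
qed

text \<open>Clearing the denominator and moving the subtracted term across gives an inequality of
  naturals; the bounds on \<open>r\<close> and \<open>k\<close> make the truncated differences agree
  with the real ones.\<close>

lemma ceiling_le_iff_nat:
  fixes n k r M m :: nat
  assumes "r \<ge> 2" "k \<ge> 1"
  shows "\<lceil>(real n - real M * (real k - 1)) / (real r - 1)\<rceil> \<le> int m \<longleftrightarrow>
    n \<le> m * (r - 1) + M * (k - 1)"
proof -
  have "\<lceil>(real n - real M * (real k - 1)) / (real r - 1)\<rceil> \<le> int m \<longleftrightarrow>
      real n - real M * (real k - 1) \<le> real m * (real r - 1)"
    using assms by (simp add: ceiling_le_iff pos_divide_le_eq)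
  also have "\<dots> \<longleftrightarrow> real n \<le> real (m * (r - 1) + M * (k - 1))"
    using assms by (simp only: of_nat_add of_nat_mult of_nat_diff of_nat_1) (simp add: algebra_simps)
  finally show ?thesis by (simp only: of_nat_le_iff)
qed

section \<open>The equivalence of (A) and (B)\<close>

theorem theorem2p2:
  shows
    "(\<forall>n k r :: nat. n \<ge> 1 \<and> k \<ge> 2 \<and> r \<ge> 2 \<and> n \<ge> r * k \<longrightarrow>
        int (chromatic_number (almost_stable_KG r r n k))
          = \<lceil>(real n - real r * (real k - 1)) / (real r - 1)\<rceil>)
     \<longleftrightarrow>
     (\<forall>n k r s :: nat. n \<ge> 1 \<and> k \<ge> 2 \<and> r \<ge> 2 \<and> s \<ge> 1 \<and> n \<ge> max r s * k \<longrightarrow>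
        int (chromatic_number (almost_stable_KG r s n k))
          = \<lceil>(real n - real (max r s) * (real k - 1)) / (real r - 1)\<rceil>)"
    (is "?A \<longleftrightarrow> ?B")
proof
  assume A: ?A
  have lower: "n \<le> chromatic_number (almost_stable_KG r r n k) * (r - 1) + r * (k - 1)"
    if "k \<ge> 2" "r \<ge> 2" "n \<ge> r * k" for n k r
  proof -
    have "n \<ge> 1" using that by (cases n) auto
    then have "int (chromatic_number (almost_stable_KG r r n k))
        = \<lceil>(real n - real r * (real k - 1)) / (real r - 1)\<rceil>"
      using A that by blast
    then show ?thesis
      using ceiling_le_iff_nat[of r k n r "chromatic_number (almost_stable_KG r r n k)"] that by simp
  qed
  show ?B
  proof (intro allI impI)
    fix n k r s :: nat
    assume h: "n \<ge> 1 \<and> k \<ge> 2 \<and> r \<ge> 2 \<and> s \<ge> 1 \<and> n \<ge> max r s * k"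
    define x where "x = \<lceil>(real n - real (max r s) * (real k - 1)) / (real r - 1)\<rceil>"
    define \<chi> where "\<chi> = chromatic_number (almost_stable_KG r s n k)"
    have x_le: "x \<le> int m \<longleftrightarrow> n \<le> m * (r - 1) + max r s * (k - 1)" for m
      unfolding x_def using h by (intro ceiling_le_iff_nat) auto
    have "max r s * (k - 1) < max r s * k" using h by (simp add: less_max_iff_disj)
    \<comment> \<open>The greedy colouring requires at least one colour, so the claimed value must
      be shown positive.\<close>
    then have "\<not> x \<le> int 0" unfolding x_le using h by linarith
    then obtain m where m: "x = int m" "m \<ge> 1" by (cases x) auto
    have "n \<le> m * (r - 1) + max r s * (k - 1)" using x_le[of m] m(1) by simp
    then obtain g where g: "proper_coloring (almost_stable_KG r s n k) g"
      "g ` fst (almost_stable_KG r s n k) \<subseteq> {..<m}"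
      using almost_stable_KG_coloring[of r k m n s] h m(2) by auto
    have "\<chi> \<le> m" unfolding \<chi>_def using g by (rule chromatic_number_le)
    moreover have "n \<le> \<chi> * (r - 1) + max r s * (k - 1)"
    proof (cases "s \<le> r")
      case True
      have "n \<le> chromatic_number (almost_stable_KG r r n k) * (r - 1) + r * (k - 1)"
        using lower h True by (simp add: max_def)
      also have "\<dots> \<le> \<chi> * (r - 1) + r * (k - 1)"
        unfolding \<chi>_def using chromatic_number_almost_stable_KG_antimono[of r k s r n] h True
        by (intro add_mono mult_right_mono) auto
      finally show ?thesis using True by (simp add: max_def)
    next
      case False
      then have s: "r < s" "max r s = s" by auto
      obtain f where "proper_coloring (almost_stable_KG r s n k) f"
        "f ` fst (almost_stable_KG r s n k) \<subseteq> {..<\<chi>}"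
        unfolding \<chi>_def using g by (rule obtain_optimal_coloring)
      then have "chromatic_number (almost_stable_KG s s (n + \<chi> * (s - r)) k) \<le> \<chi>"
        using chromatic_number_append_blocks[of r s k s n f \<chi>] s h by simp
      then have "chromatic_number (almost_stable_KG s s (n + \<chi> * (s - r)) k) * (s - 1) \<le> \<chi> * (s - 1)"
        by (rule mult_right_mono) simp
      moreover have "n + \<chi> * (s - r) \<le>
          chromatic_number (almost_stable_KG s s (n + \<chi> * (s - r)) k) * (s - 1) + s * (k - 1)"
        using h s by (intro lower) auto
      \<comment> \<open>Since \<open>s - 1 = (s - r) + (r - 1)\<close>, the
        \<open>\<chi> * (s - r)\<close> appended points cancel from the bound.\<close>
      moreover have "\<chi> * (s - 1) = \<chi> * (s - r) + \<chi> * (r - 1)"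
        using h s by (simp flip: add_mult_distrib2)
      ultimately show ?thesis unfolding s(2) by linarith
    qed
    then have "x \<le> int \<chi>" by (simp add: x_le)
    ultimately show "int (chromatic_number (almost_stable_KG r s n k)) = x"
      using m(1) by (simp add: \<chi>_def)
  qed
next
  assume B: ?B
  show ?A
  proof (intro allI impI)
    fix n k r :: nat
    assume "n \<ge> 1 \<and> k \<ge> 2 \<and> r \<ge> 2 \<and> n \<ge> r * k"
    then show "int (chromatic_number (almost_stable_KG r r n k))
        = \<lceil>(real n - real r * (real k - 1)) / (real r - 1)\<rceil>"
      using B[rule_format, of n k r r] by simp
  qed
qed

end
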